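(* Let $\alpha\in(0,1)$ and $\delta\in(0,1)$. With probability at least $1-\delta$, the following holds simultaneously for all $\mathbf{x}\in\mathcal{D}_{\mathbf{x}}$ and all integers $t\ge 1$: $$V_\alpha(f(\mathbf{x},\mathbf{Z})) \in I_{t-1}[V_\alpha(f(\mathbf{x},\mathbf{Z}))] := \big[V_\alpha(l_{t-1}(\mathbf{x},\mathbf{Z})),\ V_\alpha(u_{t-1}(\mathbf{x},\mathbf{Z}))\big].$$
   Context: Domains. $\mathcal{D}_{\mathbf{x}} \subset \mathbb{R}^{d_x}$ is a bounded set. $\mathbf{Z}$ is a random variable in $\mathbb{R}^{d_z}$ and $\mathcal{D}_{\mathbf{z}}$ is its support, i.e. the smallest closed subset of $\mathbb{R}^{d_z}$ with $P(\mathbf{Z} \in \mathcal{D}_{\mathbf{z}})=1$. The objective is an unknown function $f:\mathcal{D}_{\mathbf{x}}\times\mathcal{D}_{\mathbf{z}}\to\mathbb{R}$ in the reproducing kernel Hilbert space of $k$ with RKHS norm $\|f\|_k\le B$. Value-at-risk. For a real random variable $Y$ and $\alpha\in(0,1)$, $V_\alpha(Y) := \inf\{\omega \in \mathbb{R} : P(Y \le \omega) \ge \alpha\}$. For $g:\mathcal{D}_{\mathbf{x}}\times\mathcal{D}_{\mathbf{z}}\to\mathbb{R}$ and fixed $\mathbf{x}$, $g(\mathbf{x},\mathbf{Z})$ is the real random variable whose randomness comes only from $\mathbf{Z}$; when $g = l_{t-1}$ or $u_{t-1}$, the observations determining $g$ are held fixed. The "probability at least $1-\delta$" is with respect to the observations.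 Observations and GP posterior. $k$ is the squared exponential kernel, $\sigma_n>0$, prior mean zero. At iteration $t$ an input $(\mathbf{x}_t,\mathbf{z}_t)$ is queried and $y_t = f(\mathbf{x}_t,\mathbf{z}_t)+\epsilon_t$ is observed, with $\epsilon_t$ i.i.d. $\mathcal{N}(0,\sigma_n^2)$. With $\mathcal{D}_t$ the inputs observed up to iteration $t$ and $\mathbf{y}_{\mathcal{D}_t}$ the observations, $\mu_t(\mathbf{x},\mathbf{z}) = \mathbf{K}_{(\mathbf{x},\mathbf{z}),\mathcal{D}_t}(\mathbf{K}_{\mathcal{D}_t\mathcal{D}_t}+\sigma_n^2\mathbf{I})^{-1}\mathbf{y}_{\mathcal{D}_t}$ and $\sigma_t^2(\mathbf{x},\mathbf{z}) = k_{(\mathbf{x},\mathbf{z}),(\mathbf{x},\mathbf{z})} - \mathbf{K}_{(\mathbf{x},\mathbf{z}),\mathcal{D}_t}(\mathbf{K}_{\mathcal{D}_t\mathcal{D}_t}+\sigma_n^2\mathbf{I})^{-1}\mathbf{K}_{\mathcal{D}_t,(\mathbf{x},\mathbf{z})}$, where the $\mathbf{K}$'s are the matrices of kernel values at the indicated inputs. Confidence bounds on $f$. $l_{t-1} := \mu_{t-1} - \beta_t^{1/2}\sigma_{t-1}$ and $u_{t-1} := \mu_{t-1} + \beta_t^{1/2}\sigma_{t-1}$, where $\beta_t = (B + \sigma_n\sqrt{2(\gamma_{t-1}+1+\log(1/\delta))})^2$ and $\gamma_t$ is the maximum information gain about $f$ from $t$ observations, $\gamma_t = \sup_{|A|= t}\tfrac12\log\det(\mathbf{I}+\sigma_n^{-2}\mathbf{K}_{AA})$.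 Given (cited result of Chowdhury and Gopalan, 2017, which fixes the meaning of $\delta$ and is assumed): with probability at least $1-\delta$, $l_{t-1}(\mathbf{x},\mathbf{z})\le f(\mathbf{x},\mathbf{z})\le u_{t-1}(\mathbf{x},\mathbf{z})$ for all $\mathbf{x}\in\mathcal{D}_{\mathbf{x}}$, $\mathbf{z}\in\mathcal{D}_{\mathbf{z}}$, $t\ge1$. *)

theory Defs
  imports
    "HOL-Probability.Probability"
    "Jordan_Normal_Form.Gauss_Jordan_Elimination"
    "Jordan_Normal_Form.Determinant"
begin

(* Only a measurable event contained in the set where Q holds is asked for, because the
   statements Q of interest quantify over uncountable index sets. *)
definition with_prob_at_least :: "'w measure \<Rightarrow> real \<Rightarrow> ('w \<Rightarrow> bool) \<Rightarrow> bool" where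
  "with_prob_at_least M p Q \<longleftrightarrow> (\<exists>E\<in>sets M. p \<le> measure M E \<and> (\<forall>\<omega>\<in>E. Q \<omega>))"

definition value_at_risk :: "'v measure \<Rightarrow> real \<Rightarrow> ('v \<Rightarrow> real) \<Rightarrow> real" where
  "value_at_risk N \<alpha> Y = Inf {w. measure N {v \<in> space N. Y v \<le> w} \<ge> \<alpha>}"

definition rv_support :: "'v measure \<Rightarrow> ('v \<Rightarrow> 'a::euclidean_space) \<Rightarrow> 'a set" where
  "rv_support N Z = (LEAST C. closed C \<and> measure N {v \<in> space N. Z v \<in> C} = 1)"

lemma rv_support_wf:
  fixes Z :: "'v \<Rightarrow> 'a::euclidean_space"
  assumes "prob_space N" and Z: "Z \<in> borel_measurable N"
  shows "closed (rv_support N Z)"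
    and "measure N {v \<in> space N. Z v \<in> rv_support N Z} = 1"
    and "\<And>C. closed C \<Longrightarrow> measure N {v \<in> space N. Z v \<in> C} = 1 \<Longrightarrow> rv_support N Z \<subseteq> C"
proof -
  interpret prob_space N by fact
  define P where "P = (\<lambda>C::'a set. closed C \<and> prob {v \<in> space N. Z v \<in> C} = 1)"
  have ev: "{v \<in> space N. Z v \<in> C} \<in> events" if "closed C" for C
    using measurable_sets[OF Z borel_closed[OF that]] by (simp add: vimage_def Int_def conj_commute)
  have op: "open S" if "S \<in> uminus ` Collect P" for S
    using that by (auto simp: P_def)
  obtain \<F> where sub: "\<F> \<subseteq> uminus ` Collect P" and cnt: "countable \<F>"
    and eq: "\<Union>\<F> = \<Union>(uminus ` Collect P)"
    using Lindelof[of "uminus ` Collect P"] op by metis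
  have "AE v in N. Z v \<notin> U" if UF: "U \<in> \<F>" for U
  proof -
    obtain C where C: "P C" "U = - C" using UF sub by blast
    have "AE v in N. v \<in> {v \<in> space N. Z v \<in> C}"
      using prob_eq_1[OF ev, of C] C(1) unfolding P_def by blast
    then show ?thesis by (rule AE_mp) (use C(2) in auto)
  qed
  then have "AE v in N. \<forall>U\<in>\<F>. Z v \<notin> U"
    using AE_ball_countable[OF cnt, where M = N and P = "\<lambda>v U. Z v \<notin> U"] by blast
  then have "AE v in N. Z v \<notin> \<Union>\<F>"
    by (rule AE_mp) auto
  then have "AE v in N. v \<in> {v \<in> space N. Z v \<in> \<Inter>(Collect P)}"
    unfolding eq by (rule AE_mp) auto
  moreover have cl: "closed (\<Inter>(Collect P))"
    by (rule closed_Inter) (auto simp: P_def)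
  ultimately have "prob {v \<in> space N. Z v \<in> \<Inter>(Collect P)} = 1"
    using prob_eq_1[OF ev[OF cl]] by blast
  with cl have PI: "P (\<Inter>(Collect P))" unfolding P_def[THEN fun_cong] by blast
  have "rv_support N Z = (LEAST C. P C)"
    by (simp only: rv_support_def P_def)
  also have "\<dots> = \<Inter>(Collect P)"
    by (rule Least_equality[where P = P, OF PI]) blast
  finally have eqS: "rv_support N Z = \<Inter>(Collect P)" .
  have PS: "P (rv_support N Z)" unfolding eqS by (rule PI)
  show "closed (rv_support N Z)" using PS unfolding P_def by blast
  show "measure N {v \<in> space N. Z v \<in> rv_support N Z} = 1" using PS unfolding P_def by blast
  show "rv_support N Z \<subseteq> C" if "closed C" "measure N {v \<in> space N. Z v \<in> C} = 1" for C
    using that unfolding eqS P_def by blast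
qed

(* Signal variance s2, one length scale per coordinate; the isotropic kernel is the case of
   constant length scales. *)
definition se_kernel ::
  "real \<Rightarrow> real^'m \<Rightarrow> real^'n \<Rightarrow> (real^'m) \<times> (real^'n) \<Rightarrow> (real^'m) \<times> (real^'n) \<Rightarrow> real" where
  "se_kernel s2 lx lz = (\<lambda>(x, z) (x', z'). s2 * exp (- (1/2) *
     ((\<Sum>i\<in>UNIV. ((vec_nth x i - vec_nth x' i) / vec_nth lx i)\<^sup>2) +
      (\<Sum>j\<in>UNIV. ((vec_nth z j - vec_nth z' j) / vec_nth lz j)\<^sup>2))))"

(* A Hilbert space H, with inner product ip, of real functions on D that contains the functions
   k x and reproduces point evaluations.  A function on D is represented by a function on the
   whole type lying in "extensional D". *)
locale rkhs =
  fixes D :: "'a set" and k :: "'a \<Rightarrow> 'a \<Rightarrow> real"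
    and H :: "('a \<Rightarrow> real) set" and ip :: "('a \<Rightarrow> real) \<Rightarrow> ('a \<Rightarrow> real) \<Rightarrow> real"
  assumes carrier_ext: "H \<subseteq> extensional D"
    and zero_closed: "(\<lambda>x\<in>D. 0) \<in> H"
    and add_closed: "\<And>f g. f \<in> H \<Longrightarrow> g \<in> H \<Longrightarrow> (\<lambda>x\<in>D. f x + g x) \<in> H"
    and scale_closed: "\<And>c f. f \<in> H \<Longrightarrow> (\<lambda>x\<in>D. c * f x) \<in> H"
    and ip_commute: "\<And>f g. f \<in> H \<Longrightarrow> g \<in> H \<Longrightarrow> ip f g = ip g f"
    and ip_add_left: "\<And>f g h. f \<in> H \<Longrightarrow> g \<in> H \<Longrightarrow> h \<in> H \<Longrightarrow>
          ip (\<lambda>x\<in>D. f x + g x) h = ip f h + ip g h"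
    and ip_scale_left: "\<And>c f g. f \<in> H \<Longrightarrow> g \<in> H \<Longrightarrow> ip (\<lambda>x\<in>D. c * f x) g = c * ip f g"
    and ip_nonneg: "\<And>f. f \<in> H \<Longrightarrow> 0 \<le> ip f f"
    and ip_definite: "\<And>f. f \<in> H \<Longrightarrow> ip f f = 0 \<Longrightarrow> f = (\<lambda>x\<in>D. 0)"
    and complete: "Metric_space.mcomplete H
          (\<lambda>f g. sqrt (ip (\<lambda>x\<in>D. f x - g x) (\<lambda>x\<in>D. f x - g x)))"
    and kernel_closed: "\<And>x. x \<in> D \<Longrightarrow> restrict (k x) D \<in> H"
    and reproducing: "\<And>f x. f \<in> H \<Longrightarrow> x \<in> D \<Longrightarrow> ip f (restrict (k x) D) = f x"

definition rkhs_norm :: "(('a \<Rightarrow> real) \<Rightarrow> ('a \<Rightarrow> real) \<Rightarrow> real) \<Rightarrow> ('a \<Rightarrow> real) \<Rightarrow> real" where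
  "rkhs_norm ip f = sqrt (ip f f)"

(* Inputs X i and observations y i are numbered from i = 1. *)

definition gram_mat :: "('a \<Rightarrow> 'a \<Rightarrow> real) \<Rightarrow> (nat \<Rightarrow> 'a) \<Rightarrow> nat \<Rightarrow> real Matrix.mat" where
  "gram_mat k X t = Matrix.mat t t (\<lambda>(i, j). k (X (Suc i)) (X (Suc j)))"

definition kernel_vec :: "('a \<Rightarrow> 'a \<Rightarrow> real) \<Rightarrow> (nat \<Rightarrow> 'a) \<Rightarrow> nat \<Rightarrow> 'a \<Rightarrow> real Matrix.vec" where
  "kernel_vec k X t p = Matrix.vec t (\<lambda>i. k p (X (Suc i)))"

(* The matrix inverted here is positive definite when sn > 0, so "the" is harmless. *)
definition reg_gram_inv ::
  "('a \<Rightarrow> 'a \<Rightarrow> real) \<Rightarrow> real \<Rightarrow> (nat \<Rightarrow> 'a) \<Rightarrow> nat \<Rightarrow> real Matrix.mat" where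
  "reg_gram_inv k sn X t = the (mat_inverse (gram_mat k X t + sn\<^sup>2 \<cdot>\<^sub>m 1\<^sub>m t))"

definition gp_mean ::
  "('a \<Rightarrow> 'a \<Rightarrow> real) \<Rightarrow> real \<Rightarrow> (nat \<Rightarrow> 'a) \<Rightarrow> (nat \<Rightarrow> real) \<Rightarrow> nat \<Rightarrow> 'a \<Rightarrow> real" where
  "gp_mean k sn X y t p =
     scalar_prod (kernel_vec k X t p)
       (reg_gram_inv k sn X t *\<^sub>v Matrix.vec t (\<lambda>i. y (Suc i)))"

definition gp_var ::
  "('a \<Rightarrow> 'a \<Rightarrow> real) \<Rightarrow> real \<Rightarrow> (nat \<Rightarrow> 'a) \<Rightarrow> nat \<Rightarrow> 'a \<Rightarrow> real" where
  "gp_var k sn X t p =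
     k p p - scalar_prod (kernel_vec k X t p) (reg_gram_inv k sn X t *\<^sub>v kernel_vec k X t p)"

definition gp_sd ::
  "('a \<Rightarrow> 'a \<Rightarrow> real) \<Rightarrow> real \<Rightarrow> (nat \<Rightarrow> 'a) \<Rightarrow> nat \<Rightarrow> 'a \<Rightarrow> real" where
  "gp_sd k sn X t p = sqrt (gp_var k sn X t p)"

definition info_gain ::
  "('a \<Rightarrow> 'a \<Rightarrow> real) \<Rightarrow> real \<Rightarrow> (nat \<Rightarrow> 'a) \<Rightarrow> nat \<Rightarrow> real" where
  "info_gain k sn A t =
     1/2 * ln (Determinant.det (1\<^sub>m t + (1 / sn\<^sup>2) \<cdot>\<^sub>m gram_mat k A t))"

(* The t inputs form a family in D, so that an input may be observed several times; thus t
   observations exist for every t, also when D is finite. *)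
definition max_info_gain ::
  "'a set \<Rightarrow> ('a \<Rightarrow> 'a \<Rightarrow> real) \<Rightarrow> real \<Rightarrow> nat \<Rightarrow> real" where
  "max_info_gain D k sn t = (SUP A \<in> {1..t} \<rightarrow> D. info_gain k sn A t)"

definition conf_beta ::
  "'a set \<Rightarrow> ('a \<Rightarrow> 'a \<Rightarrow> real) \<Rightarrow> real \<Rightarrow> real \<Rightarrow> real \<Rightarrow> nat \<Rightarrow> real" where
  "conf_beta D k sn B \<delta> t =
     (B + sn * sqrt (2 * (max_info_gain D k sn (t - 1) + 1 + ln (1 / \<delta>))))\<^sup>2"

(* The bounds after t observations use the coefficient with index t + 1. *)

definition lower_conf ::
  "'a set \<Rightarrow> ('a \<Rightarrow> 'a \<Rightarrow> real) \<Rightarrow> real \<Rightarrow> real \<Rightarrow> real \<Rightarrow> (nat \<Rightarrow> 'a) \<Rightarrow> (nat \<Rightarrow> real) \<Rightarrow>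
     nat \<Rightarrow> 'a \<Rightarrow> real" where
  "lower_conf D k sn B \<delta> X y t p =
     gp_mean k sn X y t p - sqrt (conf_beta D k sn B \<delta> (t + 1)) * gp_sd k sn X t p"

definition upper_conf ::
  "'a set \<Rightarrow> ('a \<Rightarrow> 'a \<Rightarrow> real) \<Rightarrow> real \<Rightarrow> real \<Rightarrow> real \<Rightarrow> (nat \<Rightarrow> 'a) \<Rightarrow> (nat \<Rightarrow> real) \<Rightarrow>
     nat \<Rightarrow> 'a \<Rightarrow> real" where
  "upper_conf D k sn B \<delta> X y t p =
     gp_mean k sn X y t p + sqrt (conf_beta D k sn B \<delta> (t + 1)) * gp_sd k sn X t p"

end

theory Submission
  imports Defs
begin

text \<open>
  Value-at-risk is monotone under almost sure domination of real random variables. So the confidence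
  bounds on \<open>f\<close>, which hold on the support of \<open>Z\<close> and hence almost surely along \<open>Z\<close>, carry over
  to the values-at-risk on the same event. What needs work is measurability in \<open>Z\<close>: the
  bounds are built from finitely many kernel sections, and \<open>f\<close> is continuous because
  evaluation at nearby points is represented by nearby kernel sections (Cauchy--Schwarz).
\<close>

text \<open>Passing to the larger variable lowers the distribution function, so every level
  admissible for \<open>Y'\<close> is admissible for \<open>Y\<close>, and the infimum over the
  larger set is the smaller one.\<close>

lemma (in prob_space) value_at_risk_mono_AE:
  fixes Y Y' :: "'a \<Rightarrow> real"
  assumes Y: "Y \<in> borel_measurable M" and Y': "Y' \<in> borel_measurable M"
    and le: "AE v in M. Y v \<le> Y' v"
    and \<alpha>: "0 < \<alpha>" "\<alpha> < 1"
  shows "value_at_risk M \<alpha> Y \<le> value_at_risk M \<alpha> Y'"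
proof -
  have cdf_eq: "cdf (distr M borel U) w = prob {v \<in> space M. U v \<le> w}"
    if U: "U \<in> borel_measurable M" for U :: "'a \<Rightarrow> real" and w
    using U by (simp add: cdf_def measure_distr vimage_def Int_def conj_commute)
  interpret Q: real_distribution "distr M borel Y" using Y by simp
  interpret Q': real_distribution "distr M borel Y'" using Y' by simp
  \<comment> \<open>\<open>Inf\<close> on the reals is controlled only for nonempty sets bounded
    below. As \<alpha> lies strictly between the limits 0 and 1 of a distribution function,
    \<open>Y'\<close> has an admissible level \<open>w1\<close>, and the admissible levels of
    \<open>Y\<close> have the lower bound \<open>w0\<close>.\<close>
  have "eventually (\<lambda>w. \<alpha> < cdf (distr M borel Y') w) at_top"
    using order_tendstoD(1)[OF Q'.cdf_lim_at_top_prob] \<alpha>(2) by blast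
  then obtain w1 where w1: "\<alpha> \<le> prob {v \<in> space M. Y' v \<le> w1}"
    unfolding eventually_at_top_linorder cdf_eq[OF Y'] by (meson order.refl less_imp_le)
  have "eventually (\<lambda>w. cdf (distr M borel Y) w < \<alpha>) at_bot"
    using order_tendstoD(2)[OF Q.cdf_lim_at_bot] \<alpha>(1) by blast
  then obtain w0 where w0: "\<And>w. w \<le> w0 \<Longrightarrow> prob {v \<in> space M. Y v \<le> w} < \<alpha>"
    unfolding eventually_at_bot_linorder cdf_eq[OF Y] by blast
  have mono: "prob {v \<in> space M. Y' v \<le> w} \<le> prob {v \<in> space M. Y v \<le> w}" for w
  proof (rule finite_measure_mono_AE)
    show "AE v in M. v \<in> {v \<in> space M. Y' v \<le> w} \<longrightarrow> v \<in> {v \<in> space M. Y v \<le> w}"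
      using le by eventually_elim auto
    show "{v \<in> space M. Y v \<le> w} \<in> events" using Y by measurable
  qed
  show ?thesis
    unfolding value_at_risk_def
  proof (rule cInf_superset_mono)
    show "{w. prob {v \<in> space M. Y' v \<le> w} \<ge> \<alpha>} \<noteq> {}" using w1 by blast
    show "bdd_below {w. prob {v \<in> space M. Y v \<le> w} \<ge> \<alpha>}"
      by (rule bdd_belowI[of _ w0], rule ccontr)
        (metis mem_Collect_eq w0 not_le less_imp_le)
    show "{w. prob {v \<in> space M. Y' v \<le> w} \<ge> \<alpha>} \<subseteq> {w. prob {v \<in> space M. Y v \<le> w} \<ge> \<alpha>}"
      using mono by (auto intro: order_trans)
  qed
qed

context rkhs
begin

lemma ip_add_right:
  assumes "f \<in> H" "g \<in> H" "h \<in> H"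
  shows "ip f (\<lambda>x\<in>D. g x + h x) = ip f g + ip f h"
  unfolding ip_commute[OF assms(1) add_closed[OF assms(2,3)]] ip_add_left[OF assms(2,3,1)]
  by (simp only: ip_commute[OF assms(1)] assms)

lemma ip_scale_right:
  assumes "f \<in> H" "g \<in> H"
  shows "ip f (\<lambda>x\<in>D. c * g x) = c * ip f g"
  unfolding ip_commute[OF assms(1) scale_closed[OF assms(2)]] ip_scale_left[OF assms(2,1)]
  by (simp only: ip_commute[OF assms])

lemma Cauchy_Schwarz:
  assumes f: "f \<in> H" and g: "g \<in> H"
  shows "(ip f g)\<^sup>2 \<le> ip f f * ip g g"
proof (cases "ip g g = 0")
  case True
  \<comment> \<open>Written as its own multiple by 0, \<open>g\<close> has inner product 0 with
    \<open>f\<close> by homogeneity.\<close>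
  then have "g = (\<lambda>x\<in>D. 0 * g x)" using ip_definite[OF g] by simp
  then have "ip f g = 0" using ip_scale_right[OF f g, of 0] by simp
  then show ?thesis using True by simp
next
  case False
  then have pos: "ip g g > 0" using ip_nonneg[OF g] by simp
  \<comment> \<open>This \<open>c\<close> minimizes the squared norm of \<open>f + c g\<close>, a
    quadratic in \<open>c\<close>; that its minimum is nonnegative is the claim.\<close>
  define c where "c = - ip f g / ip g g"
  define cg where "cg = (\<lambda>x\<in>D. c * g x)"
  have cg: "cg \<in> H" unfolding cg_def by (rule scale_closed[OF g])
  have "0 \<le> ip (\<lambda>x\<in>D. f x + cg x) (\<lambda>x\<in>D. f x + cg x)"
    by (rule ip_nonneg[OF add_closed[OF f cg]])
  also have "\<dots> = ip f f + 2 * ip f cg + ip cg cg"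
    using ip_commute[OF f cg]
    by (simp add: ip_add_left ip_add_right f cg add_closed)
  also have "\<dots> = ip f f + 2 * c * ip f g + c\<^sup>2 * ip g g"
    using cg unfolding cg_def
    by (simp add: ip_scale_left ip_scale_right f g power2_eq_square)
  also have "\<dots> = ip f f - (ip f g)\<^sup>2 / ip g g"
    using pos unfolding c_def by (simp add: field_simps power2_eq_square)
  finally show ?thesis using pos by (simp add: field_simps)
qed

text \<open>By the reproducing property, \<open>f p - f q\<close> is the inner product of
  \<open>f\<close> with the difference of the kernel sections at \<open>p\<close> and
  \<open>q\<close>. The bracket is the squared norm of that difference, so Cauchy-Schwarz
  applies.\<close>

lemma evaluation_difference_bound:
  assumes f: "f \<in> H" and p: "p \<in> D" and q: "q \<in> D"
  shows "(f p - f q)\<^sup>2 \<le> ip f f * (k p p - k q p - (k p q - k q q))"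
proof -
  define mq where "mq = (\<lambda>x\<in>D. - 1 * restrict (k q) D x)"
  define h where "h = (\<lambda>x\<in>D. restrict (k p) D x + mq x)"
  have mq: "mq \<in> H" unfolding mq_def by (rule scale_closed[OF kernel_closed[OF q]])
  have h: "h \<in> H" unfolding h_def by (rule add_closed[OF kernel_closed[OF p] mq])
  have ip_h: "ip g h = g p - g q" if g: "g \<in> H" for g
  proof -
    have "ip g h = ip g (restrict (k p) D) + ip g mq"
      unfolding h_def by (rule ip_add_right[OF g kernel_closed[OF p] mq])
    also have "ip g mq = - 1 * ip g (restrict (k q) D)"
      unfolding mq_def by (rule ip_scale_right[OF g kernel_closed[OF q]])
    finally show ?thesis using reproducing[OF g p] reproducing[OF g q] by linarith
  qed
  \<comment> \<open>Applied to \<open>h\<close> itself, \<open>ip_h\<close> gives the squared norm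
    as \<open>h p - h q\<close>.\<close>
  have "ip h h = k p p - k q p - (k p q - k q q)"
    unfolding ip_h[OF h] using p q by (simp add: h_def mq_def)
  then show ?thesis using Cauchy_Schwarz[OF f h] ip_h[OF f] by simp
qed

end

lemma rkhs_continuous_on:
  fixes k :: "'a::topological_space \<Rightarrow> 'a \<Rightarrow> real"
  assumes "rkhs D k H ip" and f: "f \<in> H"
    and k: "continuous_on (D \<times> D) (\<lambda>(p, q). k p q)"
  shows "continuous_on D f"
  unfolding continuous_on_def
proof
  interpret rkhs D k H ip by fact
  fix q assume q: "q \<in> D"
  have kc: "continuous_on D (\<lambda>p. k (a p) (b p))"
    if "continuous_on D a" "continuous_on D b" "a ` D \<subseteq> D" "b ` D \<subseteq> D" for a b
    using continuous_on_compose2[OF k, of D "\<lambda>p. (a p, b p)"] that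
    by (auto intro: continuous_on_Pair)
  have "continuous_on D (\<lambda>p. sqrt (ip f f * (k p p - k q p - (k p q - k q q))))"
    using q by (intro continuous_intros kc) auto
  \<comment> \<open>At \<open>p = q\<close> the four kernel values cancel, so the continuous bound
    tends to 0.\<close>
  then have lim: "((\<lambda>p. sqrt (ip f f * (k p p - k q p - (k p q - k q q)))) \<longlongrightarrow> 0) (at q within D)"
    using q unfolding continuous_on_def by fastforce
  have "((\<lambda>p. f p - f q) \<longlongrightarrow> 0) (at q within D)"
  proof (rule Lim_null_comparison[OF _ lim])
    show "\<forall>\<^sub>F p in at q within D.
        norm (f p - f q) \<le> sqrt (ip f f * (k p p - k q p - (k p q - k q q)))"
      unfolding eventually_at_filter
      by (auto intro!: always_eventually real_le_rsqrt evaluation_difference_bound[OF f _ q])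
  qed
  then show "(f \<longlongrightarrow> f q) (at q within D)"
    by (simp add: LIM_zero_iff)
qed

lemma continuous_on_se_kernel:
  "continuous_on S (\<lambda>(p, q). se_kernel s2 lx lz p q)"
  \<comment> \<open>Division by a length scale becomes multiplication by a constant, which the
    product rule handles.\<close>
  unfolding se_kernel_def case_prod_beta divide_inverse
  by (intro continuous_on_mult continuous_on_const continuous_on_exp continuous_on_add
      continuous_on_sum continuous_on_power continuous_on_diff continuous_on_component
      continuous_on_fst continuous_on_snd continuous_on_id)

text \<open>
  An index outside the range of a vector yields a value that does not depend on the entries, so
  no invertibility of the regularized Gram matrix is needed here.
\<close>

lemma borel_measurable_kernel_vec:
  assumes "\<And>q. (\<lambda>v. k (P v) q) \<in> borel_measurable N"
  shows "(\<lambda>v. vec_index (kernel_vec k X t (P v)) i) \<in> borel_measurable N"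
proof (cases "i < t")
  case True
  then show ?thesis using assms by (simp add: kernel_vec_def)
next
  case False
  then have "vec_index (Matrix.vec t g) i = undef_vec (i - t)" for g :: "nat \<Rightarrow> real"
    by transfer (simp add: mk_vec_def)
  then show ?thesis by (simp add: kernel_vec_def)
qed

lemma borel_measurable_gp_mean:
  assumes "\<And>q. (\<lambda>v. k (P v) q) \<in> borel_measurable N"
  shows "(\<lambda>v. gp_mean k sn X y t (P v)) \<in> borel_measurable N"
  \<comment> \<open>Only the kernel vector depends on \<open>v\<close>, so this is a finite linear
    combination of its entries. The sum runs up to the row count of the inverse, the dimension of
    the second factor.\<close>
  unfolding gp_mean_def scalar_prod_def
  by (intro borel_measurable_sum borel_measurable_times borel_measurable_const
      borel_measurable_kernel_vec assms)

lemma borel_measurable_gp_sd: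
  assumes "\<And>q. (\<lambda>v. k (P v) q) \<in> borel_measurable N"
    and "(\<lambda>v. k (P v) (P v)) \<in> borel_measurable N"
  shows "(\<lambda>v. gp_sd k sn X t (P v)) \<in> borel_measurable N"
proof -
  let ?A = "reg_gram_inv k sn X t"
  have "(\<lambda>v. \<Sum>i<dim_row ?A. vec_index (kernel_vec k X t (P v)) i *
      (\<Sum>j<t. vec_index (Matrix.row ?A i) j * vec_index (kernel_vec k X t (P v)) j))
      \<in> borel_measurable N"
    by (intro borel_measurable_sum borel_measurable_times borel_measurable_const
      borel_measurable_kernel_vec assms)
  \<comment> \<open>The quadratic form is expanded over index ranges that do not depend on
    \<open>p\<close>: the columns run up to \<open>t\<close>, the length of the kernel
    vector.\<close>
  moreover have "scalar_prod (kernel_vec k X t p) (?A *\<^sub>v kernel_vec k X t p) =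
      (\<Sum>i<dim_row ?A. vec_index (kernel_vec k X t p) i *
        (\<Sum>j<t. vec_index (Matrix.row ?A i) j * vec_index (kernel_vec k X t p) j))" for p
    by (simp add: scalar_prod_def mult_mat_vec_def lessThan_atLeast0)
      (simp add: kernel_vec_def)
  ultimately show ?thesis
    unfolding gp_sd_def gp_var_def using assms(2) by simp
qed

theorem lemma2:
  fixes M :: "'w measure" and N :: "'v measure"
    and Z :: "'v \<Rightarrow> real^'n" and Dx :: "(real^'m) set" and Dz :: "(real^'n) set"
    and D :: "((real^'m) \<times> (real^'n)) set"
    and s2 :: real and lx :: "real^'m" and lz :: "real^'n"
    and k :: "(real^'m) \<times> (real^'n) \<Rightarrow> (real^'m) \<times> (real^'n) \<Rightarrow> real"
    and H :: "((real^'m) \<times> (real^'n) \<Rightarrow> real) set"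
    and ip :: "((real^'m) \<times> (real^'n) \<Rightarrow> real) \<Rightarrow> ((real^'m) \<times> (real^'n) \<Rightarrow> real) \<Rightarrow> real"
    and f :: "(real^'m) \<times> (real^'n) \<Rightarrow> real"
    and X :: "nat \<Rightarrow> 'w \<Rightarrow> (real^'m) \<times> (real^'n)"
    and \<epsilon> y :: "nat \<Rightarrow> 'w \<Rightarrow> real"
    and B \<sigma>\<^sub>n \<alpha> \<delta> :: real
    and l u :: "'w \<Rightarrow> nat \<Rightarrow> (real^'m) \<times> (real^'n) \<Rightarrow> real"
  assumes obs_space: "prob_space M" and Z_space: "prob_space N"
    and Z_rv: "Z \<in> borel_measurable N"
    and Dx_bounded: "bounded Dx"
    and Dz_def: "Dz = rv_support N Z"
    and D_def: "D = Dx \<times> Dz"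
    and s2_pos: "s2 > 0"
    and lx_pos: "\<And>i. vec_nth lx i > 0" and lz_pos: "\<And>j. vec_nth lz j > 0"
    and k_def: "k = se_kernel s2 lx lz"
    and H_rkhs: "rkhs D k H ip"
    and f_in: "f \<in> H" and f_norm: "rkhs_norm ip f \<le> B"
    and noise_pos: "\<sigma>\<^sub>n > 0"
    and X_rv: "\<And>t. t \<ge> 1 \<Longrightarrow> X t \<in> borel_measurable M"
    and X_in: "\<And>t \<omega>. t \<ge> 1 \<Longrightarrow> \<omega> \<in> space M \<Longrightarrow> X t \<omega> \<in> D"
    and noise_indep: "prob_space.indep_vars M (\<lambda>_. borel) \<epsilon> {1..}"
    and noise_normal: "\<And>t. t \<ge> 1 \<Longrightarrow> distributed M lborel (\<epsilon> t) (normal_density 0 \<sigma>\<^sub>n)"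
    and y_obs: "\<And>t \<omega>. t \<ge> 1 \<Longrightarrow> \<omega> \<in> space M \<Longrightarrow> y t \<omega> = f (X t \<omega>) + \<epsilon> t \<omega>"
    and alpha: "\<alpha> \<in> {0<..<1}" and delta: "\<delta> \<in> {0<..<1}"
    and l_def: "l = (\<lambda>\<omega>. lower_conf D k \<sigma>\<^sub>n B \<delta> (\<lambda>i. X i \<omega>) (\<lambda>i. y i \<omega>))"
    and u_def: "u = (\<lambda>\<omega>. upper_conf D k \<sigma>\<^sub>n B \<delta> (\<lambda>i. X i \<omega>) (\<lambda>i. y i \<omega>))"
    and conf_bounds: "with_prob_at_least M (1 - \<delta>)
          (\<lambda>\<omega>. \<forall>x\<in>Dx. \<forall>z\<in>Dz. \<forall>t\<ge>1.
             l \<omega> (t - 1) (x, z) \<le> f (x, z) \<and> f (x, z) \<le> u \<omega> (t - 1) (x, z))"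
  shows "with_prob_at_least M (1 - \<delta>)
          (\<lambda>\<omega>. \<forall>x\<in>Dx. \<forall>t\<ge>1.
             value_at_risk N \<alpha> (\<lambda>v. f (x, Z v)) \<in>
               {value_at_risk N \<alpha> (\<lambda>v. l \<omega> (t - 1) (x, Z v)) ..
                value_at_risk N \<alpha> (\<lambda>v. u \<omega> (t - 1) (x, Z v))})"
proof -
  interpret N: prob_space N by (rule Z_space)
  note wf = rv_support_wf[OF Z_space Z_rv, folded Dz_def]
  have Dz_event: "{v \<in> space N. Z v \<in> Dz} \<in> sets N"
    using Z_rv borel_closed[OF wf(1)] by measurable
  have AE_Dz: "AE v in N. Z v \<in> Dz"
    using wf(2) N.prob_eq_1[OF Dz_event] by (auto elim: AE_mp)
  have cont_k: "continuous_on S (\<lambda>(p, q). k p q)" for S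
    unfolding k_def by (rule continuous_on_se_kernel)
  \<comment> \<open>With \<open>a\<close> and \<open>b\<close> either constant or \<open>z\<close>
    mapped to \<open>(x, z)\<close>, this covers both the kernel sections and the diagonal term of
    the variance.\<close>
  have k_meas: "(\<lambda>v. k (a (Z v)) (b (Z v))) \<in> borel_measurable N"
    if "continuous_on UNIV a" "continuous_on UNIV b" for a b
  proof -
    have "continuous_on UNIV (\<lambda>z. k (a z) (b z))"
      using continuous_on_compose2[OF cont_k[of UNIV] continuous_on_Pair[OF that]] by simp
    from borel_measurable_continuous_onI[OF this] show ?thesis
      using Z_rv by simp
  qed
  have f_meas: "(\<lambda>v. f (x, Z v)) \<in> borel_measurable N" if x: "x \<in> Dx" for x
  proof -
    have "continuous_on Dz (\<lambda>z. f (x, z))"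
      by (rule continuous_on_compose2[OF rkhs_continuous_on[OF H_rkhs f_in cont_k]])
        (auto simp: D_def x intro!: continuous_intros)
    \<comment> \<open>Continuity is available only on the closed set \<open>Dz\<close>. Outside it,
      \<open>f (x, z)\<close> is the fixed value \<open>undefined\<close>, because members of
      \<open>H\<close> are extensional; so the piecewise function below is \<open>f\<close>
      itself.\<close>
    from borel_measurable_continuous_on_if[OF borel_closed[OF wf(1)] this,
        of "\<lambda>_. undefined"]
    have "(\<lambda>z. if z \<in> Dz then f (x, z) else undefined) \<in> borel_measurable borel"
      by simp
    moreover have "(\<lambda>z. if z \<in> Dz then f (x, z) else undefined) = (\<lambda>z. f (x, z))"
      using rkhs.carrier_ext[OF H_rkhs] f_in
      by (auto simp: fun_eq_iff D_def extensional_def)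
    ultimately show ?thesis using measurable_compose[OF Z_rv] by simp
  qed
  have gp_meas: "(\<lambda>v. gp_mean k \<sigma>\<^sub>n A b t (x, Z v)) \<in> borel_measurable N"
    "(\<lambda>v. gp_sd k \<sigma>\<^sub>n A t (x, Z v)) \<in> borel_measurable N" for A b t x
    by (intro borel_measurable_gp_mean borel_measurable_gp_sd k_meas continuous_intros)+
  have l_meas: "(\<lambda>v. l \<omega> t (x, Z v)) \<in> borel_measurable N"
    and u_meas: "(\<lambda>v. u \<omega> t (x, Z v)) \<in> borel_measurable N" for \<omega> t x
    unfolding l_def u_def lower_conf_def upper_conf_def using gp_meas by simp_all
  obtain E where E: "E \<in> sets M" "1 - \<delta> \<le> measure M E"
    and bounds: "\<And>\<omega> x z t. \<omega> \<in> E \<Longrightarrow> x \<in> Dx \<Longrightarrow> z \<in> Dz \<Longrightarrow> t \<ge> 1 \<Longrightarrow>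
      l \<omega> (t - 1) (x, z) \<le> f (x, z) \<and> f (x, z) \<le> u \<omega> (t - 1) (x, z)"
    using conf_bounds unfolding with_prob_at_least_def by blast
  \<comment> \<open>\<open>E\<close> was chosen before \<open>x\<close> and \<open>t\<close>, so the
    argument is deterministic in \<omega> and one event serves all \<open>x\<close> and
    \<open>t\<close> at once.\<close>
  have "value_at_risk N \<alpha> (\<lambda>v. f (x, Z v)) \<in>
      {value_at_risk N \<alpha> (\<lambda>v. l \<omega> (t - 1) (x, Z v)) ..
       value_at_risk N \<alpha> (\<lambda>v. u \<omega> (t - 1) (x, Z v))}"
    if \<omega>: "\<omega> \<in> E" and x: "x \<in> Dx" and t: "t \<ge> 1" for \<omega> x t
  proof -
    have "AE v in N. l \<omega> (t - 1) (x, Z v) \<le> f (x, Z v)"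
      "AE v in N. f (x, Z v) \<le> u \<omega> (t - 1) (x, Z v)"
      using AE_Dz by (eventually_elim, use bounds[OF \<omega> x _ t] in blast)+
    then show ?thesis
      using alpha N.value_at_risk_mono_AE l_meas u_meas f_meas[OF x] by simp
  qed
  then show ?thesis
    unfolding with_prob_at_least_def using E by blast
qed

end
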